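(* Let $0\le\varepsilon<1$ be a constant. There do not exist a (possibly randomized) algorithm for Learn-Median, a function $g:\mathbb{N}\to\mathbb{R}_{\ge0}$ with $g(T)/T\to0$ as $T\to\infty$, and a function $f$ of $(k,n,\Delta)$, such that for every $k$, every finite metric space $(V,d)$ (with $n=|V|$ and aspect ratio $\Delta$), every $T$, every sequence $V_0,\dots,V_T$ of instances, and every $Y\subseteq V$ with $|Y|=k$, \[ \sum_{t=1}^T\mathbb{E}[\rho(Y_t,V_t)]\le(1+\varepsilon)\sum_{t=1}^T\rho(Y,V_t)+g(T)\,f(k,n,\Delta), \] where $Y_t$ is the algorithm's output at time $t$.
   Context: Learn-Median: $(V,d)$ is a finite metric space with $n$ points scaled so that $\min_{x\neq y}d(x,y)=1$, and $\Delta=\max_{x,y}d(x,y)$. A sequence of instances $V_0,\dots,V_T\subseteq V$, each with at least $k+1$ distinct points, arrives online; at each time $t\ge1$, knowing $V_0,\dots,V_{t-1}$ but not $V_t$, the algorithm outputs a set $Y_t\subseteq V_0\cup\dots\cup V_{t-1}$ of $k$ points. For a set $Y$, $D(Y,x)=\min_{y\in Y}d(x,y)$, $\mathrm{Cost}_t(Y)=\sum_{x\in V_t}D(Y,x)$, $\mathrm{OPT}_t=\min_{Y\subseteq V,|Y|=k}\mathrm{Cost}_t(Y)$, $\rho(Y,V_t)=\mathrm{Cost}_t(Y)/\mathrm{OPT}_t$. *)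

theory Defs
  imports "HOL-Probability.Probability"
begin

definition min_separation :: "'a set \<Rightarrow> ('a \<Rightarrow> 'a \<Rightarrow> real) \<Rightarrow> real" where
  "min_separation V d = Min {d x y | x y. x \<in> V \<and> y \<in> V \<and> x \<noteq> y}"

definition aspect_ratio :: "'a set \<Rightarrow> ('a \<Rightarrow> 'a \<Rightarrow> real) \<Rightarrow> real" where
  "aspect_ratio V d = Max {d x y | x y. x \<in> V \<and> y \<in> V}"

definition dist_to_set :: "('a \<Rightarrow> 'a \<Rightarrow> real) \<Rightarrow> 'a set \<Rightarrow> 'a \<Rightarrow> real" where
  "dist_to_set d Y x = Min ((\<lambda>y. d x y) ` Y)"

definition cost :: "('a \<Rightarrow> 'a \<Rightarrow> real) \<Rightarrow> 'a set \<Rightarrow> 'a set \<Rightarrow> real" where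
  "cost d I Y = (\<Sum>x\<in>I. dist_to_set d Y x)"

text \<open>Candidate centres range over the whole space \<open>V\<close>, not only over the instance \<open>I\<close>.\<close>

definition opt :: "'a set \<Rightarrow> ('a \<Rightarrow> 'a \<Rightarrow> real) \<Rightarrow> nat \<Rightarrow> 'a set \<Rightarrow> real" where
  "opt V d k I = Min (cost d I ` {Y. Y \<subseteq> V \<and> card Y = k})"

definition ratio :: "'a set \<Rightarrow> ('a \<Rightarrow> 'a \<Rightarrow> real) \<Rightarrow> nat \<Rightarrow> 'a set \<Rightarrow> 'a set \<Rightarrow> real" where
  "ratio V d k Y I = cost d I Y / opt V d k I"

definition learn_median_input ::
    "nat \<Rightarrow> 'a set \<Rightarrow> ('a \<Rightarrow> 'a \<Rightarrow> real) \<Rightarrow> nat \<Rightarrow> (nat \<Rightarrow> 'a set) \<Rightarrow> bool" where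
  "learn_median_input k V d T I \<longleftrightarrow>
     1 \<le> k \<and> finite V \<and> Metric_space V d \<and> min_separation V d = 1 \<and>
     (\<forall>t\<le>T. I t \<subseteq> V \<and> k + 1 \<le> card (I t))"

text \<open>
  \<open>A k V d T [V\<^sub>0, \<dots>, V\<^sub>t\<^sub>-\<^sub>1] \<omega>\<close> is the set output at time \<open>t\<close> when the random source takes
  the value \<open>\<omega>\<close>. The same \<open>\<omega>\<close> is used at all times, so outputs may be correlated over time
  and may depend on earlier outputs. The learner may also use the number of centres, the
  metric space and the horizon; of the instances it sees only the past ones.
\<close>

type_synonym ('a, 'w) learner =
  "nat \<Rightarrow> 'a set \<Rightarrow> ('a \<Rightarrow> 'a \<Rightarrow> real) \<Rightarrow> nat \<Rightarrow> 'a set list \<Rightarrow> 'w \<Rightarrow> 'a set"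

definition history :: "(nat \<Rightarrow> 'a set) \<Rightarrow> nat \<Rightarrow> 'a set list" where
  "history I t = map I [0..<t]"

text \<open>Deterministic learners are those that ignore \<open>\<omega>\<close>.\<close>

definition learn_median_algorithm :: "'w measure \<Rightarrow> ('a, 'w) learner \<Rightarrow> bool" where
  "learn_median_algorithm M A \<longleftrightarrow>
     prob_space M \<and>
     (\<forall>k V d T I. learn_median_input k V d T I \<longrightarrow>
        (\<forall>t\<in>{1..T}.
           A k V d T (history I t) \<in> M \<rightarrow>\<^sub>M count_space UNIV \<and>
           (\<forall>\<omega>\<in>space M.
              A k V d T (history I t) \<omega> \<subseteq> (\<Union>s<t. I s) \<and>
              card (A k V d T (history I t) \<omega>) = k)))"

end

theory Submission imports Defs begin

text \<open>
  The learner may only output points seen in past instances, while the comparator is any point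
  of the space. On a star with \<open>m\<close> leaves, with all instances equal to the set of leaves and
  \<open>k = 1\<close>, the learner must always choose a leaf, at cost \<open>2 (m - 1)\<close>, whereas the fixed
  comparator that chooses the centre is optimal, with cost \<open>m\<close>. The ratio \<open>2 - 2 / m\<close>
  exceeds \<open>1 + \<epsilon>\<close> once \<open>m > 2 / (1 - \<epsilon>)\<close>.
\<close>

definition star_dist :: "'a \<Rightarrow> 'a \<Rightarrow> 'a \<Rightarrow> real" where
  "star_dist c x y = (if x = y then 0 else if x = c \<or> y = c then 1 else 2)"

text \<open>Nonzero distances are 1 or 2, and 1 + 1 already reaches the larger one, so the triangle
  inequality cannot fail, whether or not \<open>c\<close> lies in \<open>V\<close>.\<close>

lemma Metric_space_star_dist: "Metric_space V (star_dist c)"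
  by unfold_locales (auto simp: star_dist_def)

lemma cost_singleton: "cost d I {y} = (\<Sum>x\<in>I. d x y)"
  by (simp add: cost_def dist_to_set_def)

lemma cost_star_centre: "c \<notin> L \<Longrightarrow> cost (star_dist c) L {c} = card L"
proof -
  assume "c \<notin> L"
  then have "cost (star_dist c) L {c} = (\<Sum>x\<in>L. 1)"
    unfolding cost_singleton by (intro sum.cong) (auto simp: star_dist_def)
  then show ?thesis by simp
qed

text \<open>The leaf \<open>y\<close> serves itself for free, and each other leaf reaches it only
  through the centre, at distance 2.\<close>

lemma cost_star_leaf:
  assumes "finite L" "c \<notin> L" "y \<in> L"
  shows "cost (star_dist c) L {y} = 2 * (real (card L) - 1)"
proof -
  have "cost (star_dist c) L {y} = (\<Sum>x\<in>L - {y}. star_dist c x y)"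
    using assms by (simp add: cost_singleton sum.remove[of L y] star_dist_def)
  also have "\<dots> = (\<Sum>x\<in>L - {y}. 2)"
    using assms by (intro sum.cong) (auto simp: star_dist_def)
  also have "\<dots> = 2 * (real (card L) - 1)"
    using assms card_gt_0_iff[of L] by (auto simp: of_nat_diff)
  finally show ?thesis .
qed

context
  fixes L :: "'a set" and c :: 'a
  assumes fin: "finite L" and c: "c \<notin> L" and card2: "2 \<le> card L"
begin

lemma opt_star: "opt (insert c L) (star_dist c) 1 L = card L"
proof -
  have sets: "{Y. Y \<subseteq> insert c L \<and> card Y = 1} = (\<lambda>y. {y}) ` insert c L"
    by (auto simp: card_1_singleton_iff)
  \<comment> \<open>For a leaf this is \<open>2 * (m - 1) \<ge> m\<close> with
    \<open>m = card L\<close>, that is, \<open>m \<ge> 2\<close>.\<close>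
  have ge: "real (card L) \<le> cost (star_dist c) L {y}" if "y \<in> insert c L" for y
  proof (cases "y = c")
    case False
    with that show ?thesis using cost_star_leaf[OF fin c, of y] card2 by auto
  qed (use cost_star_centre[OF c] in simp)
  show ?thesis
    unfolding opt_def sets
  proof (rule Min_eqI)
    show "real (card L) \<in> cost (star_dist c) L ` (\<lambda>y. {y}) ` insert c L"
      using cost_star_centre[OF c] by auto
  qed (use fin ge in auto)
qed

lemma min_separation_star: "min_separation (insert c L) (star_dist c) = 1"
proof -
  obtain a where a: "a \<in> L" using card2 by fastforce
  define D where "D = {star_dist c x y | x y. x \<in> insert c L \<and> y \<in> insert c L \<and> x \<noteq> y}"
  \<comment> \<open>The value 1 is attained only between a leaf and the centre, hence the leaf
    \<open>a\<close>.\<close>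
  have "D \<subseteq> {1, 2}" by (auto simp: D_def star_dist_def)
  moreover have "1 \<in> D"
    unfolding D_def using a c by (intro CollectI exI[of _ a] exI[of _ c]) (auto simp: star_dist_def)
  ultimately show ?thesis
    unfolding min_separation_def D_def[symmetric] by (intro Min_eqI) (auto dest: finite_subset)
qed

lemma learn_median_input_star: "learn_median_input 1 (insert c L) (star_dist c) T (\<lambda>_. L)"
  using fin card2 by (auto simp: learn_median_input_def Metric_space_star_dist min_separation_star)

lemma ratio_star_centre: "ratio (insert c L) (star_dist c) 1 {c} L = 1"
  using card2 by (simp add: ratio_def opt_star[simplified] cost_star_centre[OF c])

lemma ratio_star_leaf:
  "y \<in> L \<Longrightarrow> ratio (insert c L) (star_dist c) 1 {y} L = 2 - 2 / card L"
  using card2 by (simp add: ratio_def opt_star[simplified] cost_star_leaf[OF fin c] field_simps)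

text \<open>Randomness cannot help: every past instance is \<open>L\<close>, so for each
  \<open>\<omega>\<close> the output is a single leaf. All leaves have the same ratio, so the
  integrand is constant on \<open>space M\<close>.\<close>

lemma expectation_ratio_star:
  assumes alg: "learn_median_algorithm M A" and t: "t \<in> {1..T}"
  shows "prob_space.expectation M (\<lambda>\<omega>. ratio (insert c L) (star_dist c) 1
           (A 1 (insert c L) (star_dist c) T (history (\<lambda>_. L) t) \<omega>) L) = 2 - 2 / card L"
proof -
  interpret prob_space M using alg by (simp add: learn_median_algorithm_def)
  have "\<forall>k V d T I. learn_median_input k V d T I \<longrightarrow> (\<forall>t\<in>{1..T}. \<forall>\<omega>\<in>space M.
          A k V d T (history I t) \<omega> \<subseteq> (\<Union>s<t. I s) \<and> card (A k V d T (history I t) \<omega>) = k)"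
    using alg by (simp add: learn_median_algorithm_def)
  from this[rule_format, OF learn_median_input_star t]
  have out: "A 1 (insert c L) (star_dist c) T (history (\<lambda>_. L) t) \<omega> \<subseteq> L"
            "card (A 1 (insert c L) (star_dist c) T (history (\<lambda>_. L) t) \<omega>) = 1"
    if "\<omega> \<in> space M" for \<omega>
    using that by fastforce+
  have "ratio (insert c L) (star_dist c) 1
          (A 1 (insert c L) (star_dist c) T (history (\<lambda>_. L) t) \<omega>) L = 2 - 2 / card L"
    if "\<omega> \<in> space M" for \<omega>
    by (rule card_1_singletonE[OF out(2)[OF that]]) (use out(1)[OF that] ratio_star_leaf in simp)
  then show ?thesis
    by (simp add: prob_space cong: Bochner_Integration.integral_cong)
qed

end

theorem theorem6:
  fixes \<epsilon> :: real
  assumes "0 \<le> \<epsilon>" and "\<epsilon> < 1"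
    and "infinite (UNIV :: 'a set)"
  shows "\<not> (\<exists>(M :: 'w measure) (A :: ('a, 'w) learner) (g :: nat \<Rightarrow> real)
              (f :: nat \<Rightarrow> nat \<Rightarrow> real \<Rightarrow> real).
            learn_median_algorithm M A \<and>
            (\<forall>T. 0 \<le> g T) \<and> (\<lambda>T. g T / real T) \<longlonglongrightarrow> 0 \<and>
            (\<forall>k V d T I Y. learn_median_input k V d T I \<and> Y \<subseteq> V \<and> card Y = k \<longrightarrow>
               (\<Sum>t=1..T. prob_space.expectation M
                   (\<lambda>\<omega>. ratio V d k (A k V d T (history I t) \<omega>) (I t)))
               \<le> (1 + \<epsilon>) * (\<Sum>t=1..T. ratio V d k Y (I t))
                  + g T * f k (card V) (aspect_ratio V d)))"
proof (intro notI, elim exE conjE)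
  fix M :: "'w measure" and A :: "('a, 'w) learner" and g :: "nat \<Rightarrow> real"
    and f :: "nat \<Rightarrow> nat \<Rightarrow> real \<Rightarrow> real"
  assume alg: "learn_median_algorithm M A" and lim: "(\<lambda>T. g T / real T) \<longlonglongrightarrow> 0"
    and bound: "\<forall>k V d T I Y. learn_median_input k V d T I \<and> Y \<subseteq> V \<and> card Y = k \<longrightarrow>
               (\<Sum>t=1..T. prob_space.expectation M
                   (\<lambda>\<omega>. ratio V d k (A k V d T (history I t) \<omega>) (I t)))
               \<le> (1 + \<epsilon>) * (\<Sum>t=1..T. ratio V d k Y (I t))
                  + g T * f k (card V) (aspect_ratio V d)"
  \<comment> \<open>This threshold is \<open>2 / m < 1 - \<epsilon>\<close> solved for
    \<open>m\<close>. It is at least 2 because \<open>\<epsilon> \<ge> 0\<close>.\<close>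
  obtain m :: nat where m: "2 / (1 - \<epsilon>) < real m" using reals_Archimedean2 by blast
  have "2 \<le> 2 / (1 - \<epsilon>)" using assms(1,2) by (simp add: field_simps)
  with m have m2: "2 \<le> m" by linarith
  have gap: "1 + \<epsilon> < 2 - 2 / real m"
    using m m2 assms(2) by (simp add: field_simps)
  obtain L :: "'a set" where L: "finite L" "card L = m"
    using infinite_arbitrarily_large[OF assms(3)] by blast
  obtain c where c: "c \<notin> L" using ex_new_if_finite[OF assms(3) L(1)] by blast
  have card2: "2 \<le> card L" using L m2 by simp
  let ?V = "insert c L" and ?d = "star_dist c"
  \<comment> \<open>The star is fixed before \<open>T\<close> varies, so \<open>C\<close> does not
    depend on \<open>T\<close>.\<close>
  define C where "C = f 1 (card ?V) (aspect_ratio ?V ?d)"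
  have "real T * (2 - 2 / real m) \<le> (1 + \<epsilon>) * real T + g T * C" for T
    using bound[rule_format, of 1 ?V ?d T "\<lambda>_. L" "{c}"]
      learn_median_input_star[OF L(1) c card2, of T]
      expectation_ratio_star[OF L(1) c card2 alg, of _ T]
      ratio_star_centre[OF L(1) c card2]
    by (simp add: C_def L(2))
  \<comment> \<open>Per-step averages: the additive term becomes \<open>g T / T\<close> times a
    constant and vanishes in the limit, whatever the sign of \<open>C\<close>, while the gap between
    the ratios stays.\<close>
  then have le: "2 - 2 / real m \<le> (1 + \<epsilon>) + g T / real T * C" if "T \<ge> 1" for T
    using that by (simp add: field_simps)
  have "(\<lambda>T. (1 + \<epsilon>) + g T / real T * C) \<longlonglongrightarrow> (1 + \<epsilon>) + 0 * C"
    by (intro tendsto_intros lim)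
  then have "2 - 2 / real m \<le> (1 + \<epsilon>) + 0 * C"
    by (rule LIMSEQ_le_const) (use le in blast)
  with gap show False by simp
qed

end
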